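(* Let $G$ be a finite simple graph such that $I(G)^s$ has linear quotients for some integer $s\ge 1$, and fix a vertex $x$ of $G$. Then $I(G^{[x]})^s$ has linear quotients if and only if $G^{[x]}$ is gapfree.
   Context: For a finite simple graph $G$ on vertices $1,\ldots,n$, its edge ideal $I(G)\subseteq K[x_1,\ldots,x_n]$ ($K$ a field) is generated by the monomials $x_ix_j$ for the edges $\{i,j\}$ of $G$. A monomial ideal generated in a single degree has linear quotients if its minimal monomial generators can be ordered $u_1>\cdots>u_r$ so that each colon ideal $(u_1,\ldots,u_i):u_{i+1}$, $1\le i<r$, is generated by a subset of the variables. A graph is gapfree if for any two edges $e,e'$ with $e\cap e'=\emptyset$ there is an edge $f$ with $e\cap f\neq\emptyset$ and $e'\cap f\neq\emptyset$. The expansion $G^{[x]}$ of $G$ at $x$ is obtained by adding a new vertex $y$ with edge set $E(G)\cup\{yb : xb\in E(G)\}\cup\{xy\}$ (with a new variable for $y$). *)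

theory Defs
  imports Main "HOL-Library.Multiset"
begin

text \<open>Monomials in variables of type 'v are represented by their exponent
vectors, i.e. finite multisets of variables; multiplication is (+) and
divisibility is the sub-multiset relation.  A monomial ideal of
K[x_v] is determined by (and identified with) the set of monomials it contains.\<close>

type_synonym 'v monomial = "'v multiset"

definition ideal_gen :: "'v monomial set \<Rightarrow> 'v monomial set" where
  "ideal_gen U = {m. \<exists>u\<in>U. u \<subseteq># m}"

definition colon :: "'v monomial set \<Rightarrow> 'v monomial \<Rightarrow> 'v monomial set" where
  "colon I u = {m. m + u \<in> I}"

definition min_gens :: "'v monomial set \<Rightarrow> 'v monomial set" where
  "min_gens I = {u \<in> I. \<forall>v\<in>I. v \<subseteq># u \<longrightarrow> v = u}"

definition linear_quotients :: "'v monomial set \<Rightarrow> bool" where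
  "linear_quotients I \<longleftrightarrow>
     (\<exists>us. distinct us \<and> set us = min_gens I \<and>
        (\<forall>i. 1 \<le> i \<and> i < length us \<longrightarrow>
           (\<exists>S. colon (ideal_gen (set (take i us))) (us ! i)
                 = ideal_gen ((\<lambda>v. {#v#}) ` S))))"

definition simple_graph :: "'a set \<Rightarrow> 'a set set \<Rightarrow> bool" where
  "simple_graph V E \<longleftrightarrow> finite V \<and> (\<forall>e\<in>E. e \<subseteq> V \<and> card e = 2)"

definition edge_ideal :: "'a set set \<Rightarrow> 'a monomial set" where
  "edge_ideal E = ideal_gen (mset_set ` E)"

definition edge_ideal_pow :: "'a set set \<Rightarrow> nat \<Rightarrow> 'a monomial set" where
  "edge_ideal_pow E s =
     ideal_gen {sum_list (map mset_set es) | es. length es = s \<and> set es \<subseteq> E}"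

definition gapfree :: "'a set set \<Rightarrow> bool" where
  "gapfree E \<longleftrightarrow> (\<forall>e\<in>E. \<forall>e'\<in>E. e \<inter> e' = {} \<longrightarrow>
                      (\<exists>f\<in>E. e \<inter> f \<noteq> {} \<and> e' \<inter> f \<noteq> {}))"

text \<open>Expansion at x: old vertices v become Some v, the new vertex y is None.\<close>
definition expansion_vertices :: "'a set \<Rightarrow> 'a option set" where
  "expansion_vertices V = Some ` V \<union> {None}"

definition expansion_edges :: "'a set set \<Rightarrow> 'a \<Rightarrow> 'a option set set" where
  "expansion_edges E x =
     (\<lambda>e. Some ` e) ` E \<union> {{None, Some b} | b. {x, b} \<in> E} \<union> {{Some x, None}}"

end

theory Submission
  imports Defs "HOL-Library.List_Lexorder"
begin

text \<open>
  If \<open>e, e'\<close> form a gap, then the powers \<open>e\<^sup>s\<close> and \<open>e'\<^sup>s\<close> already violate linear quotients: no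
  product of edges differs from \<open>e\<^sup>s\<close> by trading one variable for a variable of \<open>e'\<close>.

  Conversely, gapfreeness at the edge \<open>xy\<close> of the expansion makes the neighbourhood \<open>N\<close> of \<open>x\<close> a
  vertex cover of \<open>G\<close>.  The generators of \<open>N\<close>-degree at least \<open>s\<close> are the preimages of the generators
  of \<open>I(G)\<^sup>s\<close> under \<open>y \<mapsto> x\<close>; they come first, in the given order of \<open>I(G)\<^sup>s\<close>.  Let \<open>W\<close> consist of the
  vertices outside \<open>N \<union> {x, y}\<close>.  A monomial of degree \<open>2s\<close> and \<open>N\<close>-degree \<open>d \<le> s\<close> is a generator if and
  only if \<open>x\<close> and \<open>y\<close> occur in it at least \<open>s - d\<close> times each and its part in \<open>W\<close> can be matched into
  its part in \<open>N\<close>.  Hence \<open>x\<close> can be traded for any vertex of \<open>N\<close>, and a vertex of \<open>W\<close> for \<open>x\<close> or \<open>y\<close>, so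
  that larger \<open>N\<close>-degree and then larger \<open>{x, y}\<close>-degree come first.  Remaining ties are broken
  lexicographically, the trades within \<open>W\<close> being provided by the exchange property of transversal
  matroids.
\<close>

section \<open>Multisets\<close>

lemma ex_count_less:
  assumes "size A \<le> size B" "A \<noteq> B"
  obtains v where "count A v < count B v"
proof (rule ccontr)
  assume "\<not> thesis"
  then have "B \<subseteq># A" using that by (meson mset_subset_eqI not_less)
  then have "B \<subset># A" using assms(2) by auto
  then show False using assms(1) by (auto dest: mset_subset_size)
qed

lemma ex_count_less_filter:
  assumes "size {#v \<in># A. Q v#} \<le> size {#v \<in># B. Q v#}" "{#v \<in># A. Q v#} \<noteq> {#v \<in># B. Q v#}"
  obtains v where "Q v" "count A v < count B v"
proof -
  obtain v where "count {#v \<in># A. Q v#} v < count {#v \<in># B. Q v#} v"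
    using ex_count_less[OF assms] .
  then show ?thesis using that[of v] by (auto split: if_splits)
qed

lemma count_image_mset_eq_size: "count (image_mset f M) b = size {#a \<in># M. f a = b#}"
  by (simp add: count_conv_size_mset filter_mset_image_mset)

lemma count_image_mset_less:
  assumes "count (image_mset f A) b < count (image_mset f B) b"
  obtains a where "f a = b" "count A a < count B a"
proof (rule ex_count_less_filter[where Q = "\<lambda>a. f a = b"])
  show "size {#a \<in># A. f a = b#} \<le> size {#a \<in># B. f a = b#}"
    using assms by (simp add: count_image_mset_eq_size)
  show "{#a \<in># A. f a = b#} \<noteq> {#a \<in># B. f a = b#}"
    using assms unfolding count_image_mset_eq_size by auto
qed (rule that)

lemma count_image_mset_balance:
  assumes "count (image_mset f A) (f a) \<le> count (image_mset f B) (f a)" "count B a < count A a"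
  obtains a' where "f a' = f a" "count A a' < count B a'"
proof (rule ex_count_less_filter[where Q = "\<lambda>u. f u = f a"])
  show "size {#u \<in># A. f u = f a#} \<le> size {#u \<in># B. f u = f a#}"
    using assms(1) by (simp add: count_image_mset_eq_size)
  have "count {#u \<in># B. f u = f a#} a < count {#u \<in># A. f u = f a#} a" using assms(2) by simp
  then show "{#u \<in># A. f u = f a#} \<noteq> {#u \<in># B. f u = f a#}" by (metis order_less_irrefl)
qed (rule that)

lemma member_of_count_less: "count A v < count B v \<Longrightarrow> v \<in># B"
  by (metis count_inI not_less_zero)

section \<open>Linear quotients of equigenerated ideals\<close>

definition exchangeable :: "'v monomial set \<Rightarrow> 'v monomial \<Rightarrow> 'v monomial \<Rightarrow> bool" where
  "exchangeable T u t \<longleftrightarrow> (\<exists>v w R. u = add_mset w R \<and> add_mset v R \<in> T \<and> count u v < count t v)"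

lemma exchangeableI:
  "u = add_mset w R \<Longrightarrow> add_mset v R \<in> T \<Longrightarrow> count u v < count t v \<Longrightarrow> exchangeable T u t"
  unfolding exchangeable_def by blast

lemma exchangeableE:
  assumes "exchangeable T u t"
  obtains v w R where "u = add_mset w R" "add_mset v R \<in> T" "count u v < count t v"
  using assms unfolding exchangeable_def by blast

lemma exchangeable_mono: "exchangeable T u t \<Longrightarrow> T \<subseteq> T' \<Longrightarrow> exchangeable T' u t"
  unfolding exchangeable_def by blast

lemma min_gens_ideal_gen:
  assumes "\<forall>u\<in>P. size u = d"
  shows "min_gens (ideal_gen P) = P"
proof -
  have antichain: "u = v" if "u \<in> P" "v \<in> P" "u \<subseteq># v" for u v
    using that assms by (metis mset_subset_size order_less_irrefl subset_mset.le_imp_less_or_eq)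
  show ?thesis
    unfolding min_gens_def ideal_gen_def
    by (auto; metis antichain subset_mset.order_trans subset_mset.order_refl subset_mset.antisym)
qed

lemma colon_ideal_gen: "colon (ideal_gen T) u = {m. \<exists>t\<in>T. t \<subseteq># m + u}"
  by (simp add: colon_def ideal_gen_def)

lemma singleton_in_colon_iff_exchange:
  assumes "\<forall>t\<in>T. size t = size u" "u \<notin> T"
  shows "{#v#} \<in> colon (ideal_gen T) u \<longleftrightarrow> (\<exists>w R. u = add_mset w R \<and> add_mset v R \<in> T)"
proof
  assume "{#v#} \<in> colon (ideal_gen T) u"
  then obtain t where t: "t \<in> T" "t \<subseteq># add_mset v u" by (auto simp: colon_ideal_gen)
  then obtain D where D: "add_mset v u = t + D" by (metis subset_mset.le_iff_add)
  have "size D = 1" using arg_cong[OF D, of size] assms(1) t(1) by simp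
  then obtain w where "D = {#w#}" by (metis size_1_singleton_mset)
  then have "add_mset v u = add_mset w t" using D by simp
  moreover have "t \<noteq> u" using t(1) assms(2) by blast
  ultimately show "\<exists>w R. u = add_mset w R \<and> add_mset v R \<in> T"
    using t(1) unfolding add_eq_conv_ex by blast
next
  assume "\<exists>w R. u = add_mset w R \<and> add_mset v R \<in> T"
  then obtain w R where R: "u = add_mset w R" "add_mset v R \<in> T" by blast
  have "add_mset v R \<subseteq># {#v#} + u" by (simp add: R(1))
  then show "{#v#} \<in> colon (ideal_gen T) u" using R(2) unfolding colon_ideal_gen by blast
qed

lemma colon_linear_iff_exchangeable:
  assumes "\<forall>t\<in>T. size t = size u" "u \<notin> T"
  shows "(\<exists>S. colon (ideal_gen T) u = ideal_gen ((\<lambda>v. {#v#}) ` S)) \<longleftrightarrow> (\<forall>t\<in>T. exchangeable T u t)"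
proof
  assume "\<exists>S. colon (ideal_gen T) u = ideal_gen ((\<lambda>v. {#v#}) ` S)"
  then obtain S where S: "colon (ideal_gen T) u = ideal_gen ((\<lambda>v. {#v#}) ` S)" ..
  show "\<forall>t\<in>T. exchangeable T u t"
  proof
    fix t assume "t \<in> T"
    moreover have "t \<subseteq># (t - u) + u" by (auto simp: subseteq_mset_def)
    ultimately have "t - u \<in> colon (ideal_gen T) u" by (auto simp: colon_ideal_gen)
    then obtain v where v: "v \<in> S" "v \<in># t - u" unfolding S by (auto simp: ideal_gen_def)
    then have "{#v#} \<in> colon (ideal_gen T) u" unfolding S by (auto simp: ideal_gen_def)
    moreover have "count u v < count t v" using v(2) by (simp add: in_diff_count)
    ultimately show "exchangeable T u t"
      unfolding singleton_in_colon_iff_exchange[OF assms] exchangeable_def by blast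
  qed
next
  assume exchange: "\<forall>t\<in>T. exchangeable T u t"
  let ?C = "colon (ideal_gen T) u" and ?S = "{v. {#v#} \<in> colon (ideal_gen T) u}"
  have "\<exists>v. {#v#} \<in> ?C \<and> {#v#} \<subseteq># m" if m: "m \<in> ?C" for m
  proof -
    from m obtain t where t: "t \<in> T" "t \<subseteq># m + u" by (auto simp: colon_ideal_gen)
    then obtain v w R where v: "u = add_mset w R" "add_mset v R \<in> T" "count u v < count t v"
      using exchange by (meson exchangeableE)
    have "v \<in># m" using v(3) mset_subset_eq_count[OF t(2), of v] by (auto simp flip: count_greater_zero_iff)
    then show ?thesis using v(1,2) singleton_in_colon_iff_exchange[OF assms] by auto
  qed
  moreover have "m \<in> ?C" if "{#v#} \<in> ?C" "{#v#} \<subseteq># m" for m v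
    using that unfolding colon_ideal_gen mem_Collect_eq
    by (meson subset_mset.add_right_mono subset_mset.order_trans)
  ultimately have "?C = ideal_gen ((\<lambda>v. {#v#}) ` ?S)" by (auto simp: ideal_gen_def)
  then show "\<exists>S. ?C = ideal_gen ((\<lambda>v. {#v#}) ` S)" ..
qed

lemma linear_quotients_iff_exchangeable:
  assumes "\<forall>u\<in>P. size u = d"
  shows "linear_quotients (ideal_gen P) \<longleftrightarrow>
    (\<exists>us. distinct us \<and> set us = P \<and>
      (\<forall>i<length us. \<forall>t\<in>set (take i us). exchangeable (set (take i us)) (us ! i) t))"
proof -
  have colon_iff: "(\<exists>S. colon (ideal_gen (set (take i us))) (us ! i) = ideal_gen ((\<lambda>v. {#v#}) ` S))
      \<longleftrightarrow> (\<forall>t\<in>set (take i us). exchangeable (set (take i us)) (us ! i) t)"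
    if us: "distinct us" "set us = P" and i: "i < length us" for us i
  proof (rule colon_linear_iff_exchangeable)
    show "\<forall>t\<in>set (take i us). size t = size (us ! i)"
      using assms us(2) i by (metis in_set_takeD nth_mem)
    show "us ! i \<notin> set (take i us)"
      using us(1) i by (auto simp: in_set_conv_nth nth_eq_iff_index_eq)
  qed
  have "(\<forall>i. 1 \<le> i \<and> i < length us \<longrightarrow> (\<exists>S. colon (ideal_gen (set (take i us))) (us ! i)
          = ideal_gen ((\<lambda>v. {#v#}) ` S)))
      \<longleftrightarrow> (\<forall>i<length us. \<forall>t\<in>set (take i us). exchangeable (set (take i us)) (us ! i) t)"
    if "distinct us" "set us = P" for us
    using colon_iff[OF that] by (auto simp: Suc_le_eq) (metis empty_iff gr0I list.set(1) take_0)
  then show ?thesis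
    unfolding linear_quotients_def min_gens_ideal_gen[OF assms]
    by (intro ex_cong1) (auto simp only: conj_assoc intro!: conj_cong)
qed

definition linear_quotient_key :: "'v monomial set \<Rightarrow> ('v monomial \<Rightarrow> 'k::linorder) \<Rightarrow> bool" where
  "linear_quotient_key P key \<longleftrightarrow> inj_on key P \<and>
     (\<forall>u\<in>P. \<forall>t\<in>P. key t < key u \<longrightarrow> exchangeable {m \<in> P. key m < key u} u t)"

lemma set_take_sorted_key:
  fixes key :: "'b \<Rightarrow> 'k::linorder"
  assumes "sorted_wrt (<) (map key us)" "i < length us"
  shows "set (take i us) = {u \<in> set us. key u < key (us ! i)}"
proof -
  have "key (us ! j) < key (us ! i) \<longleftrightarrow> j < i" if "j < length us" for j
    using assms that sorted_wrt_nth_less[OF assms(1)]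
    by (metis length_map linorder_neqE_nat nth_map order_less_asym order_less_irrefl)
  moreover have "set (take i us) = (!) us ` {0..<i}" using assms(2) by (simp add: nth_image)
  moreover have "set us = (!) us ` {0..<length us}" by (metis nth_image order_refl take_all)
  ultimately show ?thesis using assms(2) by auto
qed

lemma linear_quotient_key_iff_take:
  fixes key :: "'v monomial \<Rightarrow> 'k::linorder"
  assumes "sorted_wrt (<) (map key us)"
  shows "linear_quotient_key (set us) key \<longleftrightarrow>
    (\<forall>i<length us. \<forall>t\<in>set (take i us). exchangeable (set (take i us)) (us ! i) t)"
proof -
  let ?before = "\<lambda>u. {m \<in> set us. key m < key u}"
  have "inj_on key (set us)" using assms by (simp add: strict_sorted_iff distinct_map)
  then have "linear_quotient_key (set us) key \<longleftrightarrow>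
      (\<forall>u\<in>set us. \<forall>t\<in>?before u. exchangeable (?before u) u t)"
    unfolding linear_quotient_key_def by auto
  also have "\<dots> \<longleftrightarrow> (\<forall>i<length us. \<forall>t\<in>?before (us ! i). exchangeable (?before (us ! i)) (us ! i) t)"
    by (rule all_set_conv_all_nth)
  finally show ?thesis by (simp add: set_take_sorted_key[OF assms])
qed

lemma linear_quotientsI:
  fixes key :: "'v monomial \<Rightarrow> 'k::linorder"
  assumes "finite P" "\<forall>u\<in>P. size u = d" and key: "linear_quotient_key P key"
  shows "linear_quotients (ideal_gen P)"
proof -
  obtain us where us: "set us = P" "distinct us" using finite_distinct_list[OF assms(1)] by blast
  define ks where "ks = sort_key key us"
  have ks: "set ks = P" "distinct ks" by (simp_all add: ks_def us)
  moreover have "inj_on key P" using key by (simp add: linear_quotient_key_def)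
  ultimately have "sorted_wrt (<) (map key ks)"
    by (simp add: ks_def strict_sorted_iff distinct_map)
  then show ?thesis
    using ks key linear_quotient_key_iff_take[of key ks]
    unfolding linear_quotients_iff_exchangeable[OF assms(2)] by blast
qed

lemma linear_quotientsE:
  assumes "linear_quotients (ideal_gen P)" "\<forall>u\<in>P. size u = d"
  obtains key :: "'v monomial \<Rightarrow> nat" where "linear_quotient_key P key"
proof -
  obtain us where us: "distinct us" "set us = P"
    "\<forall>i<length us. \<forall>t\<in>set (take i us). exchangeable (set (take i us)) (us ! i) t"
    using assms(1) unfolding linear_quotients_iff_exchangeable[OF assms(2)] by blast
  define key where "key = the_inv_into {..<length us} ((!) us)"
  have "inj_on ((!) us) {..<length us}" using us(1) by (simp add: inj_on_nth)
  then have "key (us ! i) = i" if "i < length us" for i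
    unfolding key_def using that by (simp add: the_inv_into_f_f)
  then have "map key us = [0..<length us]" by (intro nth_equalityI) simp_all
  then have "sorted_wrt (<) (map key us)" by simp
  then have "linear_quotient_key P key" using us linear_quotient_key_iff_take[of key us] by blast
  then show ?thesis by (rule that)
qed

section \<open>The lexicographic order\<close>

definition lex_key :: "'v list \<Rightarrow> 'v monomial \<Rightarrow> int list" where
  "lex_key vs M = map (\<lambda>v. - int (count M v)) vs"

lemma map_less_map_iff:
  fixes f g :: "'b \<Rightarrow> 'c::order"
  shows "map f vs < map g vs \<longleftrightarrow>
    (\<exists>i<length vs. (\<forall>j<i. f (vs ! j) = g (vs ! j)) \<and> f (vs ! i) < g (vs ! i))"
proof (induction vs)
  case (Cons v vs)
  then show ?case
    by (auto simp: Ex_less_Suc2 All_less_Suc2)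
qed simp

lemma inj_on_lex_key: "inj_on (lex_key vs) {M. set_mset M \<subseteq> set vs}"
proof (rule inj_onI)
  fix M M' assume M: "M \<in> {M. set_mset M \<subseteq> set vs}" "M' \<in> {M. set_mset M \<subseteq> set vs}"
    and "lex_key vs M = lex_key vs M'"
  then have "count M v = count M' v" if "v \<in> set vs" for v using that by (simp add: lex_key_def)
  moreover have "count M v = 0 \<and> count M' v = 0" if "v \<notin> set vs" for v
    using that M by (auto simp: count_eq_zero_iff)
  ultimately show "M = M'" by (metis multiset_eqI)
qed

lemma lex_key_exchange:
  assumes "lex_key vs M' < lex_key vs M"
  obtains v where "count M v < count M' v"
    "\<And>w R. M = add_mset w R \<Longrightarrow> count M' w < count M w \<Longrightarrow> lex_key vs (add_mset v R) < lex_key vs M"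
proof -
  obtain i where i: "i < length vs" "\<forall>j<i. count M' (vs ! j) = count M (vs ! j)"
    "count M (vs ! i) < count M' (vs ! i)"
    using assms unfolding lex_key_def map_less_map_iff by auto
  have "lex_key vs (add_mset (vs ! i) R) < lex_key vs M"
    if w: "M = add_mset w R" "count M' w < count M w" for w R
  proof -
    have "\<forall>j<i. vs ! j \<noteq> vs ! i \<and> vs ! j \<noteq> w"
      using i(2,3) w(2) by (metis order_less_irrefl)
    moreover have "vs ! i \<noteq> w" using i(3) w(2) by auto
    ultimately show ?thesis
      unfolding lex_key_def map_less_map_iff using i(1) w(1) by (intro exI[of _ i]) auto
  qed
  then show ?thesis using that i(3) by blast
qed

section \<open>Substitution of variables\<close>

lemma exchangeable_vimage:
  assumes "exchangeable T (image_mset f M) (image_mset f M')"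
  shows "exchangeable {L. image_mset f L \<in> T} M M'"
proof -
  obtain v w R where R: "image_mset f M = add_mset w R" "add_mset v R \<in> T"
    and v: "count (image_mset f M) v < count (image_mset f M') v"
    using assms by (rule exchangeableE)
  obtain v' where v': "f v' = v" "count M v' < count M' v'"
    using v by (rule count_image_mset_less)
  obtain w' R' where R': "M = add_mset w' R'" "image_mset f R' = R"
    using msed_map_invR[OF R(1)] by blast
  then show ?thesis using R(2) v' by (intro exchangeableI[OF R'(1) _ v'(2)]) auto
qed

lemma exchangeable_fiber:
  assumes fiber: "image_mset f M' = image_mset f M" and less: "lex_key vs M' < lex_key vs M"
  shows "exchangeable {L. image_mset f L = image_mset f M \<and> lex_key vs L < lex_key vs M} M M'"
proof -
  obtain v where v: "count M v < count M' v"
    and lex: "\<And>w R. M = add_mset w R \<Longrightarrow> count M' w < count M w \<Longrightarrow>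
      lex_key vs (add_mset v R) < lex_key vs M"
    using lex_key_exchange[OF less] by blast
  have "count (image_mset f M') (f v) \<le> count (image_mset f M) (f v)" by (simp add: fiber)
  then obtain w where w: "f w = f v" "count M' w < count M w"
    using v by (rule count_image_mset_balance)
  obtain R where "M = add_mset w R" using member_of_count_less[OF w(2)] by (metis mset_add)
  then show ?thesis using v w lex by (intro exchangeableI[of M w R v]) auto
qed

section \<open>Bipartite matchings\<close>

definition matchable :: "('a \<times> 'b) set \<Rightarrow> 'a multiset \<Rightarrow> 'b multiset \<Rightarrow> bool" where
  "matchable R A B \<longleftrightarrow> (\<exists>F. set_mset F \<subseteq> R \<and> image_mset fst F \<subseteq># A \<and> image_mset snd F = B)"

lemma matchable_empty: "matchable R A {#}"
  unfolding matchable_def by (intro exI[of _ "{#}"]) auto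

lemma matchable_mono:
  assumes "matchable R A B" "A \<subseteq># A'" "B' \<subseteq># B"
  shows "matchable R A' B'"
proof -
  obtain F where F: "set_mset F \<subseteq> R" "image_mset fst F \<subseteq># A" "image_mset snd F = B"
    using assms(1) unfolding matchable_def by blast
  obtain C where "B = B' + C" using assms(3) by (metis subset_mset.le_iff_add)
  then obtain F' D where D: "F = F' + D" "image_mset snd F' = B'"
    using F(3) by (metis image_mset_eq_plusD)
  have "image_mset fst F' \<subseteq># A'"
    using F(2) assms(2) unfolding D(1) by (metis image_mset_union mset_subset_eq_add_left subset_mset.order_trans)
  then show ?thesis using F(1) D unfolding matchable_def by auto
qed

lemma matchable_add:
  assumes "(p, q) \<in> R" "matchable R A B"
  shows "matchable R (add_mset p A) (add_mset q B)"
proof -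
  obtain F where F: "set_mset F \<subseteq> R" "image_mset fst F \<subseteq># A" "image_mset snd F = B"
    using assms(2) unfolding matchable_def by blast
  then show ?thesis
    using assms(1) unfolding matchable_def by (intro exI[of _ "add_mset (p, q) F"]) auto
qed

lemma size_diff_exchange_less:
  assumes "count F' f < count (add_mset f F0) f" "count (add_mset f F0) e < count F' e"
  shows "size (add_mset e F0 - F') < size (add_mset f F0 - F')"
proof -
  have "add_mset f F0 - F' = add_mset f (F0 - F')"
    using assms(1) by (intro multiset_eqI) auto
  moreover have "add_mset e F0 - F' = F0 - F'"
    using assms(2) by (intro multiset_eqI) (auto split: if_splits)
  ultimately show ?thesis by simp
qed

lemma matching_alternating_edge:
  fixes F F' :: "('a \<times> 'b) multiset"
  assumes "count (image_mset snd F) q < count (image_mset snd F') q" "image_mset fst F' \<subseteq># A"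
  obtains p where "count F (p, q) < count F' (p, q)" "count (image_mset fst F) p < count A p"
  | p z where "count F (p, q) < count F' (p, q)" "count F' (p, z) < count F (p, z)"
proof -
  obtain p where p: "count F (p, q) < count F' (p, q)"
    using assms(1) by (rule count_image_mset_less) (metis surjective_pairing)
  show ?thesis
  proof (cases "count (image_mset fst F) p < count A p")
    case True
    then show ?thesis using p that(1) by blast
  next
    case False
    then have "count (image_mset fst F') (fst (p, q)) \<le> count (image_mset fst F) (fst (p, q))"
      using mset_subset_eq_count[OF assms(2), of p] by simp
    then obtain e where "fst e = fst (p, q)" "count F' e < count F e"
      using p by (rule count_image_mset_balance)
    then show ?thesis using p that(2)[of p "snd e"] by auto
  qed
qed

lemma matchable_augment:
  assumes "set_mset F \<subseteq> R" "image_mset fst F \<subseteq># A" "(p, q) \<in> R" "count (image_mset fst F) p < count A p"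
  shows "matchable R A (add_mset q (image_mset snd F))"
proof -
  have "image_mset fst (add_mset (p, q) F) \<subseteq># A"
  proof (rule mset_subset_eqI)
    show "count (image_mset fst (add_mset (p, q) F)) a \<le> count A a" for a
      using mset_subset_eq_count[OF assms(2), of a] assms(4) by auto
  qed
  then show ?thesis
    using assms(1,3) unfolding matchable_def by (intro exI[of _ "add_mset (p, q) F"]) simp
qed

lemma matchable_drop_surplus:
  assumes "matchable R A (add_mset q B)" "size B' \<le> size B" "count B q < count B' q"
  shows "\<exists>r C. B = add_mset r C \<and> count B' r < count B r \<and> matchable R A (add_mset q C)"
proof -
  have "B' \<noteq> B" using assms(3) by auto
  with assms(2) obtain r where r: "count B' r < count B r" by (rule ex_count_less)
  obtain C where C: "B = add_mset r C" using member_of_count_less[OF r] by (metis mset_add)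
  have "matchable R A (add_mset q C)" using assms(1) by (rule matchable_mono) (simp_all add: C)
  then show ?thesis using r C by blast
qed

text \<open>Augmenting-path argument: exchanging \<open>(p, z)\<close> for \<open>(p, q)\<close> either closes the path
  or brings \<open>F\<close> closer to \<open>F'\<close>, with \<open>z\<close> as the new deficient vertex.\<close>

lemma matching_exchange:
  fixes F F' :: "('a \<times> 'b) multiset"
  assumes "set_mset F \<subseteq> R" "image_mset fst F \<subseteq># A" "set_mset F' \<subseteq> R" "image_mset fst F' \<subseteq># A"
    and "size F' \<le> size F" "count (image_mset snd F) q < count (image_mset snd F') q"
  shows "\<exists>r C. image_mset snd F = add_mset r C \<and>
    count (image_mset snd F') r < count (image_mset snd F) r \<and> matchable R A (add_mset q C)"
  using assms
proof (induction "size (F - F')" arbitrary: F q rule: less_induct)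
  case less
  let ?B = "image_mset snd F" and ?B' = "image_mset snd F'"
  from less.prems(6,4) show ?case
  proof (cases rule: matching_alternating_edge)
    case (1 p)
    have "(p, q) \<in> R" using member_of_count_less[OF 1(1)] less.prems(3) by blast
    have "matchable R A (add_mset q ?B)"
      using less.prems(1,2) \<open>(p, q) \<in> R\<close> 1(2) by (rule matchable_augment)
    then show ?thesis by (rule matchable_drop_surplus) (use less.prems(5,6) in simp_all)
  next
    case (2 p z)
    have "(p, q) \<in> R" using member_of_count_less[OF 2(1)] less.prems(3) by blast
    have "q \<noteq> z" using 2 by auto
    obtain F0 where F0: "F = add_mset (p, z) F0" using member_of_count_less[OF 2(2)] by (metis mset_add)
    let ?G = "add_mset (p, q) F0" and ?S = "image_mset snd F0"
    have G: "set_mset ?G \<subseteq> R" "image_mset fst ?G \<subseteq># A" "size F' \<le> size ?G"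
      using less.prems(1,2,5) F0 \<open>(p, q) \<in> R\<close> by auto
    have B: "?B = add_mset z ?S" and G_snd: "image_mset snd ?G = add_mset q ?S" by (simp_all add: F0)
    show ?thesis
    proof (cases "count ?B' z < count ?B z")
      case True
      have "matchable R A (add_mset q ?S)" using G(1,2) G_snd unfolding matchable_def by metis
      then show ?thesis using True B by blast
    next
      case False
      then have z: "count (image_mset snd ?G) z < count ?B' z" using \<open>q \<noteq> z\<close> unfolding B G_snd by auto
      have "size (?G - F') < size (F - F')"
        using size_diff_exchange_less[of F' "(p, z)" F0 "(p, q)"] 2 F0 by simp
      from less.hyps[OF this G(1,2) less.prems(3,4) G(3) z] obtain r C
        where C: "image_mset snd ?G = add_mset r C" "count ?B' r < count (image_mset snd ?G) r"
          "matchable R A (add_mset z C)" by blast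
      have "r \<noteq> q" using C(2) less.prems(6) \<open>q \<noteq> z\<close> unfolding B G_snd by auto
      then obtain D where D: "C = add_mset q D" "?S = add_mset r D"
        using C(1) unfolding G_snd add_eq_conv_ex by auto
      have "?B = add_mset r (add_mset z D)" by (simp add: B D(2))
      moreover have "count ?B' r < count ?B r" using C(2) \<open>r \<noteq> q\<close> unfolding B G_snd by auto
      moreover have "matchable R A (add_mset q (add_mset z D))"
        using C(3) D(1) by (simp add: add_mset_commute)
      ultimately show ?thesis by blast
    qed
  qed
qed

lemma matchable_exchange:
  assumes "matchable R A B" "matchable R A B'" "size B' \<le> size B" "count B q < count B' q"
  obtains r C where "B = add_mset r C" "count B' r < count B r" "matchable R A (add_mset q C)"
proof -
  obtain F where F: "set_mset F \<subseteq> R" "image_mset fst F \<subseteq># A" "image_mset snd F = B"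
    using assms(1) unfolding matchable_def by blast
  obtain F' where F': "set_mset F' \<subseteq> R" "image_mset fst F' \<subseteq># A" "image_mset snd F' = B'"
    using assms(2) unfolding matchable_def by blast
  have "size F' \<le> size F" using assms(3) F(3) F'(3) by auto
  then show ?thesis
    using matching_exchange[OF F(1,2) F'(1,2)] assms(4) that unfolding F(3) F'(3) by blast
qed

section \<open>Products of edges\<close>

definition edge_prods :: "'a set set \<Rightarrow> nat \<Rightarrow> 'a monomial set" where
  "edge_prods E s = {sum_list (map mset_set es) | es. length es = s \<and> set es \<subseteq> E}"

lemma edge_ideal_pow_eq: "edge_ideal_pow E s = ideal_gen (edge_prods E s)"
  by (simp add: edge_ideal_pow_def edge_prods_def)

lemma edge_prods_0: "edge_prods E 0 = {{#}}"
  by (auto simp: edge_prods_def)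

lemma edge_prods_Suc: "edge_prods E (Suc s) = {mset_set e + M | e M. e \<in> E \<and> M \<in> edge_prods E s}"
proof (intro set_eqI iffI)
  fix M assume "M \<in> edge_prods E (Suc s)"
  then show "M \<in> {mset_set e + M | e M. e \<in> E \<and> M \<in> edge_prods E s}"
    by (fastforce simp: edge_prods_def length_Suc_conv)
next
  fix M assume "M \<in> {mset_set e + M | e M. e \<in> E \<and> M \<in> edge_prods E s}"
  then obtain e es where "M = sum_list (map mset_set (e # es))" "e \<in> E" "length es = s" "set es \<subseteq> E"
    by (auto simp: edge_prods_def)
  then show "M \<in> edge_prods E (Suc s)" unfolding edge_prods_def by (intro CollectI exI[of _ "e # es"]) auto
qed

lemma finite_edge_prods:
  assumes "finite E"
  shows "finite (edge_prods E s)"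
proof -
  have "edge_prods E s = (\<lambda>es. sum_list (map mset_set es)) ` {es. set es \<subseteq> E \<and> length es = s}"
    by (auto simp: edge_prods_def)
  then show ?thesis using assms by (simp add: finite_lists_length_eq)
qed

lemma edge_prods_mono: "E \<subseteq> E' \<Longrightarrow> edge_prods E s \<subseteq> edge_prods E' s"
  by (auto simp: edge_prods_def)

lemma repeat_mset_edge_prods: "e \<in> E \<Longrightarrow> repeat_mset s (mset_set e) \<in> edge_prods E s"
  by (induction s) (auto simp: edge_prods_0 edge_prods_Suc)

locale simple_edges =
  fixes E :: "'a set set"
  assumes card_edge: "e \<in> E \<Longrightarrow> card e = 2"
begin

lemma finite_edge: "e \<in> E \<Longrightarrow> finite e"
  using card_edge by (metis card.infinite zero_neq_numeral)

lemma ends_distinct: "{a, b} \<in> E \<Longrightarrow> a \<noteq> b"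
  using card_edge[of "{a, b}"] by auto

lemma edge_endsE:
  assumes "e \<in> E"
  obtains a b where "e = {a, b}" "a \<noteq> b"
  using card_edge[OF assms] by (auto simp: card_2_iff)

lemma edge_at_vertexE:
  assumes "e \<in> E" "a \<in> e"
  obtains b where "e = {a, b}" "a \<noteq> b"
  using edge_endsE[OF assms(1)] assms(2) by (metis insert_commute insert_iff singletonD)

lemma edge_prods_SucI:
  assumes "{a, b} \<in> E" "M \<in> edge_prods E s"
  shows "add_mset a (add_mset b M) \<in> edge_prods E (Suc s)"
proof -
  have "add_mset a (add_mset b M) = mset_set {a, b} + M" using ends_distinct[OF assms(1)] by simp
  then show ?thesis using assms unfolding edge_prods_Suc by blast
qed

lemma edge_prods_SucE:
  assumes "M \<in> edge_prods E (Suc s)"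
  obtains a b L where "{a, b} \<in> E" "M = add_mset a (add_mset b L)" "L \<in> edge_prods E s"
proof -
  obtain e L where e: "e \<in> E" "M = mset_set e + L" "L \<in> edge_prods E s"
    using assms unfolding edge_prods_Suc by blast
  obtain a b where "e = {a, b}" "a \<noteq> b" using edge_endsE[OF e(1)] .
  then show ?thesis using e that by simp
qed

lemma size_edge_prods: "M \<in> edge_prods E s \<Longrightarrow> size M = 2 * s"
  by (induction s arbitrary: M) (auto simp: edge_prods_0 elim!: edge_prods_SucE)

lemma edge_prods_edge_at:
  assumes "M \<in> edge_prods E s" "v \<in># M"
  shows "\<exists>f\<in>E. v \<in> f \<and> f \<subseteq> set_mset M"
  using assms
proof (induction s arbitrary: M)
  case (Suc s)
  from Suc.prems(1) obtain a b L where M: "{a, b} \<in> E" "M = add_mset a (add_mset b L)"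
    and L: "L \<in> edge_prods E s" by (rule edge_prods_SucE)
  show ?case
  proof (cases "v \<in> {a, b}")
    case True
    then show ?thesis using M by (intro bexI[OF _ M(1)]) auto
  next
    case False
    then have "v \<in># L" using Suc.prems(2) M(2) by simp
    then obtain f where "f \<in> E" "v \<in> f" "f \<subseteq> set_mset L" using Suc.IH[OF L] by blast
    then show ?thesis using M(2) by (intro bexI[of _ f]) auto
  qed
qed (simp add: edge_prods_0)

lemma set_mset_edge_prods: "M \<in> edge_prods E s \<Longrightarrow> set_mset M \<subseteq> \<Union>E"
  using edge_prods_edge_at by blast

lemma exchangeable_edge_powers_imp_joining_edge:
  assumes e: "e \<in> E" "e' \<in> E" "e \<inter> e' = {}"
    and "exchangeable (edge_prods E s) (repeat_mset s (mset_set e)) (repeat_mset s (mset_set e'))"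
  shows "\<exists>f\<in>E. e \<inter> f \<noteq> {} \<and> e' \<inter> f \<noteq> {}"
proof -
  obtain v w R where R: "repeat_mset s (mset_set e) = add_mset w R" "add_mset v R \<in> edge_prods E s"
    and "count (repeat_mset s (mset_set e)) v < count (repeat_mset s (mset_set e')) v"
    using assms(4) by (rule exchangeableE)
  then have "v \<in> e'" by (auto simp: count_mset_set' split: if_splits)
  obtain f where f: "f \<in> E" "v \<in> f" "f \<subseteq> set_mset (add_mset v R)"
    using edge_prods_edge_at[OF R(2)] by auto
  obtain b where b: "f = {v, b}" "v \<noteq> b" using edge_at_vertexE[OF f(1,2)] .
  then have "b \<in># repeat_mset s (mset_set e)" using f(3) R(1) by simp
  then have "b \<in># mset_set e" by (metis count_eq_zero_iff count_repeat_mset mult_0_right)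
  then have "b \<in> e" using finite_edge[OF e(1)] by simp
  then show ?thesis using f(1,2) b(1) \<open>v \<in> e'\<close> by (intro bexI[of _ f]) auto
qed

lemma linear_quotients_imp_gapfree:
  assumes "s \<ge> 1" "linear_quotients (edge_ideal_pow E s)"
  shows "gapfree E"
proof -
  let ?P = "edge_prods E s" and ?power = "\<lambda>e. repeat_mset s (mset_set e)"
  obtain key :: "'a monomial \<Rightarrow> nat" where key: "linear_quotient_key ?P key"
    using assms(2) size_edge_prods unfolding edge_ideal_pow_eq by (metis linear_quotientsE)
  have meet: "\<exists>f\<in>E. e \<inter> f \<noteq> {} \<and> e' \<inter> f \<noteq> {}"
    if e: "e \<in> E" "e' \<in> E" "e \<inter> e' = {}" and less: "key (?power e') < key (?power e)" for e e'
  proof (rule exchangeable_edge_powers_imp_joining_edge[OF e])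
    show "exchangeable ?P (?power e) (?power e')"
      using key less repeat_mset_edge_prods[OF e(1), of s] repeat_mset_edge_prods[OF e(2), of s]
      unfolding linear_quotient_key_def by (blast intro: exchangeable_mono)
  qed
  show ?thesis unfolding gapfree_def
  proof (intro ballI impI)
    fix e e' assume e: "e \<in> E" "e' \<in> E" "e \<inter> e' = {}"
    obtain v where "v \<in> e" using edge_endsE[OF e(1)] by blast
    then have "count (?power e) v \<noteq> count (?power e') v"
      using e finite_edge assms(1) by (auto simp: count_mset_set')
    then have "?power e \<noteq> ?power e'" by metis
    moreover have "inj_on key ?P" using key by (simp add: linear_quotient_key_def)
    ultimately have "key (?power e) \<noteq> key (?power e')"
      using e(1,2) by (simp add: inj_on_eq_iff repeat_mset_edge_prods)
    then consider "key (?power e') < key (?power e)" | "key (?power e) < key (?power e')" by linarith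
    then show "\<exists>f\<in>E. e \<inter> f \<noteq> {} \<and> e' \<inter> f \<noteq> {}"
      using meet[of e e'] meet[of e' e] e by cases (auto simp: Int_commute)
  qed
qed

end

section \<open>Adjacent twins with dominating neighbourhood\<close>

abbreviation restrict_mset :: "'a set \<Rightarrow> 'a multiset \<Rightarrow> 'a multiset" where
  "restrict_mset S M \<equiv> {#v \<in># M. v \<in> S#}"

definition deg_in :: "'a set \<Rightarrow> 'a multiset \<Rightarrow> nat" where
  "deg_in S M = size (restrict_mset S M)"

lemma deg_in_simps [simp]:
  "deg_in S {#} = 0"
  "deg_in S (add_mset v M) = (if v \<in> S then Suc (deg_in S M) else deg_in S M)"
  "deg_in S (A + B) = deg_in S A + deg_in S B"
  "deg_in S (replicate_mset k v) = (if v \<in> S then k else 0)"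
  by (simp_all add: deg_in_def) (induction k, auto)

lemma deg_in_posE:
  assumes "0 < deg_in S M"
  obtains v where "v \<in> S" "v \<in># M"
proof -
  obtain v where "v \<in># restrict_mset S M"
    using assms unfolding deg_in_def by (metis multiset_nonemptyE nonempty_has_size)
  then show ?thesis using that by auto
qed

lemma two_members_splitE:
  assumes "a \<in># M" "b \<in># M" "a \<noteq> b"
  obtains L where "M = add_mset a (add_mset b L)"
  using assms by (metis insert_DiffM insert_noteq_member)

locale dominating_twins = simple_edges H for H :: "'b set set" +
  fixes x y :: 'b and N :: "'b set"
  assumes xy: "{x, y} \<in> H"
    and xN: "p \<in> N \<Longrightarrow> {x, p} \<in> H"
    and yN: "p \<in> N \<Longrightarrow> {y, p} \<in> H"
    and cover: "e \<in> H \<Longrightarrow> e \<noteq> {x, y} \<Longrightarrow> e \<inter> N \<noteq> {}"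
begin

abbreviation W :: "'b set" where "W \<equiv> - (N \<union> {x, y})"

lemma twins_distinct [simp]: "x \<noteq> y" "y \<noteq> x" "x \<notin> N" "y \<notin> N"
  using ends_distinct[OF xy] ends_distinct[OF xN] ends_distinct[OF yN] by auto

lemma N_neq_twins [simp]: "p \<in> N \<Longrightarrow> p \<noteq> x" "p \<in> N \<Longrightarrow> p \<noteq> y"
  by auto

lemma ends_cover: "{a, b} \<in> H \<Longrightarrow> a \<in> N \<or> b \<in> N \<or> {a, b} = {x, y}"
  using cover[of "{a, b}"] by auto

lemma size_eq_degrees: "size M = count M x + count M y + deg_in N M + deg_in W M"
  by (induction M) auto

definition NW_edges :: "('b \<times> 'b) set" where
  "NW_edges = {(p, q). p \<in> N \<and> q \<in> W \<and> {p, q} \<in> H}"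

definition W_matchable :: "'b multiset \<Rightarrow> bool" where
  "W_matchable M \<longleftrightarrow> matchable NW_edges (restrict_mset N M) (restrict_mset W M)"

lemma W_matchable_add_NW:
  "p \<in> N \<Longrightarrow> q \<in> W \<Longrightarrow> {p, q} \<in> H \<Longrightarrow> W_matchable M \<Longrightarrow> W_matchable (add_mset p (add_mset q M))"
  using matchable_add[of p q NW_edges] by (auto simp: W_matchable_def NW_edges_def)

lemma W_matchable_mono:
  assumes "W_matchable M" "restrict_mset N M \<subseteq># restrict_mset N M'"
    "restrict_mset W M' \<subseteq># restrict_mset W M"
  shows "W_matchable M'"
  using assms matchable_mono unfolding W_matchable_def by blast

lemma edge_prods_imp_W_matchable: "M \<in> edge_prods H s \<Longrightarrow> W_matchable M"
proof (induction s arbitrary: M)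
  case 0
  then show ?case by (simp add: edge_prods_0 W_matchable_def matchable_empty)
next
  case (Suc s)
  from Suc.prems obtain a b L where M: "{a, b} \<in> H" "M = add_mset a (add_mset b L)"
    and L: "L \<in> edge_prods H s" by (rule edge_prods_SucE)
  have WL: "W_matchable L" using Suc.IH[OF L] .
  consider "a \<in> W" | "b \<in> W" | "a \<notin> W" "b \<notin> W" by blast
  then show ?case
  proof cases
    case 1
    then have "b \<in> N" using ends_cover[OF M(1)] by (auto simp: doubleton_eq_iff)
    then show ?thesis
      using W_matchable_add_NW[of b a L] 1 WL M by (simp add: insert_commute add_mset_commute)
  next
    case 2
    then have "a \<in> N" using ends_cover[OF M(1)] by (auto simp: doubleton_eq_iff)
    then show ?thesis using W_matchable_add_NW[of a b L] 2 WL M by simp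
  next
    case 3
    then show ?thesis using W_matchable_mono[OF WL, of M] M(2) by auto
  qed
qed

lemma edge_prods_imp_twin_count_ge:
  "M \<in> edge_prods H s \<Longrightarrow> s \<le> deg_in N M + count M x \<and> s \<le> deg_in N M + count M y"
proof (induction s arbitrary: M)
  case (Suc s)
  from Suc.prems obtain a b L where M: "{a, b} \<in> H" "M = add_mset a (add_mset b L)"
    and L: "L \<in> edge_prods H s" by (rule edge_prods_SucE)
  show ?case using Suc.IH[OF L] ends_cover[OF M(1)] M(2) by (auto simp: doubleton_eq_iff)
qed simp

lemma edge_prods_without_W:
  assumes "size M = 2 * s" "deg_in W M = 0" "deg_in N M \<le> s"
    "s \<le> deg_in N M + count M x" "s \<le> deg_in N M + count M y"
  shows "M \<in> edge_prods H s"
  using assms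
proof (induction s arbitrary: M)
  case (Suc s)
  show ?case
  proof (cases "deg_in N M = 0")
    case True
    then have "x \<in># M" "y \<in># M" using Suc.prems by (auto simp flip: count_greater_zero_iff)
    then obtain L where M: "M = add_mset x (add_mset y L)"
      using twins_distinct by (metis two_members_splitE)
    have "L \<in> edge_prods H s" by (rule Suc.IH) (use Suc.prems True in \<open>auto simp: M\<close>)
    then show ?thesis unfolding M by (rule edge_prods_SucI[OF xy])
  next
    case False
    then obtain p where p: "p \<in> N" "p \<in># M" by (metis deg_in_posE gr0I)
    have "Suc s < deg_in N M + count M x \<or> Suc s < deg_in N M + count M y"
      using size_eq_degrees[of M] Suc.prems(1,2) False by arith
    then obtain z where z: "z \<in> {x, y}" "Suc s < deg_in N M + count M z" by blast
    then have "z \<in># M" "z \<noteq> p" using Suc.prems(3) p(1) by (auto simp flip: count_greater_zero_iff)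
    then obtain L where M: "M = add_mset z (add_mset p L)" using p(2) by (metis two_members_splitE)
    have "L \<in> edge_prods H s" by (rule Suc.IH) (use Suc.prems z p(1) in \<open>auto simp: M\<close>)
    then show ?thesis unfolding M using z(1) xN[OF p(1)] yN[OF p(1)] by (auto intro: edge_prods_SucI)
  qed
qed (simp add: edge_prods_0)

lemma edge_prods_of_W_matchable:
  assumes "W_matchable M" "size M = 2 * s" "deg_in N M \<le> s"
    "s \<le> deg_in N M + count M x" "s \<le> deg_in N M + count M y"
  shows "M \<in> edge_prods H s"
proof -
  obtain F where "set_mset F \<subseteq> NW_edges" "image_mset fst F \<subseteq># restrict_mset N M"
    "image_mset snd F = restrict_mset W M"
    using assms(1) unfolding W_matchable_def matchable_def by blast
  then show ?thesis using assms(2-)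
  proof (induction F arbitrary: M s)
    case empty
    then have "deg_in W M = 0" by (simp add: deg_in_def)
    then show ?case using empty by (blast intro: edge_prods_without_W)
  next
    case (add e F)
    obtain p q where e: "e = (p, q)" "p \<in> N" "q \<in> W" "{p, q} \<in> H"
      using add.prems(1) by (auto simp: NW_edges_def)
    have "p \<in># restrict_mset N M" using add.prems(2) e by (simp add: insert_subset_eq_iff)
    moreover have "q \<in># restrict_mset W M"
      using add.prems(3) e(1) by (metis image_mset_add_mset snd_conv union_single_eq_member)
    ultimately obtain L where M: "M = add_mset p (add_mset q L)"
      using e(2,3) two_members_splitE[of p M q] by auto
    obtain t where s: "s = Suc t" using add.prems(4) M by (cases s) auto
    have "L \<in> edge_prods H t"
      by (rule add.IH) (use add.prems e M s in \<open>auto simp: insert_subset_eq_iff\<close>)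
    then show ?case unfolding M s by (rule edge_prods_SucI[OF e(4)])
  qed
qed

lemma edge_prods_iff_W_matchable:
  assumes "deg_in N M \<le> s"
  shows "M \<in> edge_prods H s \<longleftrightarrow> W_matchable M \<and> size M = 2 * s \<and>
    s \<le> deg_in N M + count M x \<and> s \<le> deg_in N M + count M y"
  using edge_prods_imp_W_matchable edge_prods_imp_twin_count_ge size_edge_prods
    edge_prods_of_W_matchable assms by blast

subsection \<open>Trading variables\<close>

lemma trade_twin_for_N:
  assumes M: "M \<in> edge_prods H s" "deg_in N M < s" and p: "p \<in> N"
  obtains R where "M = add_mset x R" "add_mset p R \<in> edge_prods H s"
proof -
  note criterion = edge_prods_iff_W_matchable[OF less_imp_le[OF M(2)]]
  have "x \<in># M" using M criterion by (auto simp flip: count_greater_zero_iff)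
  then obtain R where R: "M = add_mset x R" by (metis mset_add)
  have "W_matchable (add_mset p R)"
    using edge_prods_imp_W_matchable[OF M(1)] by (rule W_matchable_mono) (use p R in auto)
  then have "add_mset p R \<in> edge_prods H s"
    using M criterion p edge_prods_iff_W_matchable[of "add_mset p R" s] by (auto simp: R)
  then show ?thesis using R that by blast
qed

lemma trade_W_for_twin:
  assumes "add_mset q R \<in> edge_prods H s" "deg_in N R \<le> s" "q \<in> W" "z \<in> {x, y}"
  shows "add_mset z R \<in> edge_prods H s"
proof -
  have "W_matchable (add_mset z R)"
    using edge_prods_imp_W_matchable[OF assms(1)] by (rule W_matchable_mono) (use assms(3,4) in auto)
  then show ?thesis
    using assms edge_prods_iff_W_matchable[of "add_mset q R" s] edge_prods_iff_W_matchable[of "add_mset z R" s]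
    by auto
qed

lemma trade_twins:
  assumes "add_mset w R \<in> edge_prods H s" "deg_in N R \<le> s" "{v, w} = {x, y}"
    "s \<le> deg_in N R + count R w"
  shows "add_mset v R \<in> edge_prods H s"
proof -
  have vw: "v = x \<and> w = y \<or> v = y \<and> w = x" using assms(3) by (auto simp: doubleton_eq_iff)
  have "W_matchable (add_mset v R)"
    using edge_prods_imp_W_matchable[OF assms(1)] by (rule W_matchable_mono) (use vw in auto)
  then show ?thesis
    using assms(1,2,4) vw
      edge_prods_iff_W_matchable[of "add_mset w R" s] edge_prods_iff_W_matchable[of "add_mset v R" s]
    by auto
qed

lemma trade_within_W:
  assumes M: "M \<in> edge_prods H s" "M' \<in> edge_prods H s" "deg_in N M \<le> s"
    and parts: "restrict_mset N M' = restrict_mset N M" "deg_in W M' = deg_in W M"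
    and q: "q \<in> W" "count M q < count M' q"
  obtains r R where "r \<in> W" "M = add_mset r R" "count M' r < count M r" "add_mset q R \<in> edge_prods H s"
proof -
  let ?A = "restrict_mset N M" and ?W = "\<lambda>L. restrict_mset W L"
  have "matchable NW_edges ?A (?W M)" "matchable NW_edges ?A (?W M')"
    using edge_prods_imp_W_matchable[OF M(1)] edge_prods_imp_W_matchable[OF M(2)] parts(1)
    by (simp_all add: W_matchable_def)
  moreover have "size (?W M') \<le> size (?W M)" using parts(2) by (simp add: deg_in_def)
  moreover have "count (?W M) q < count (?W M') q" using q by simp
  ultimately obtain r C where r: "?W M = add_mset r C" "count (?W M') r < count (?W M) r"
    and C: "matchable NW_edges ?A (add_mset q C)" by (rule matchable_exchange)
  have rM: "r \<in> W" "count M' r < count M r" using r(2) by (auto split: if_splits)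
  obtain R where R: "M = add_mset r R" using member_of_count_less[OF rM(2)] by (metis mset_add)
  have "W_matchable (add_mset q R)"
    using C r(1) rM(1) q(1) by (simp add: W_matchable_def R)
  then have "add_mset q R \<in> edge_prods H s"
    using M(1,3) edge_prods_iff_W_matchable[of M s] edge_prods_iff_W_matchable[of "add_mset q R" s] rM(1) q(1)
    by (auto simp: R)
  then show ?thesis using rM R that by blast
qed

lemma exchangeable_equal_degrees:
  assumes M: "M \<in> edge_prods H s" "M' \<in> edge_prods H s" and low: "deg_in N M \<le> s"
    and parts: "restrict_mset N M' = restrict_mset N M" "deg_in W M' = deg_in W M"
    and less: "lex_key vs M' < lex_key vs M"
  shows "exchangeable {L \<in> edge_prods H s. deg_in N L = deg_in N M \<and> deg_in W L = deg_in W M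
           \<and> lex_key vs L < lex_key vs M} M M'"
proof -
  obtain v where v: "count M v < count M' v"
    and lex: "\<And>w R. M = add_mset w R \<Longrightarrow> count M' w < count M w \<Longrightarrow>
      lex_key vs (add_mset v R) < lex_key vs M"
    using lex_key_exchange[OF less] by blast
  have "v \<notin> N"
    using v parts(1) by (metis (mono_tags) count_filter_mset order_less_irrefl)
  then consider "v \<in> {x, y}" | "v \<in> W" by auto
  then show ?thesis
  proof cases
    case 1
    then obtain w where w: "{v, w} = {x, y}" by blast
    have degN: "deg_in N M' = deg_in N M" using parts(1) by (simp add: deg_in_def)
    have "count M x + count M y = count M' x + count M' y"
      using size_eq_degrees[of M] size_eq_degrees[of M'] size_edge_prods[OF M(1)] size_edge_prods[OF M(2)]
        degN parts(2) by linarith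
    then have surplus: "count M' w < count M w" using v w by (auto simp: doubleton_eq_iff)
    then obtain R where R: "M = add_mset w R" using member_of_count_less by (metis mset_add)
    have "s \<le> deg_in N M' + count M' w"
      using edge_prods_imp_twin_count_ge[OF M(2)] w by (auto simp: doubleton_eq_iff)
    then have "add_mset v R \<in> edge_prods H s"
      using M(1) low surplus w degN unfolding R by (intro trade_twins[OF _ _ w]) (auto simp: doubleton_eq_iff)
    then show ?thesis
      using lex[OF R surplus] w v by (intro exchangeableI[OF R _ v]) (auto simp: R doubleton_eq_iff)
  next
    case 2
    obtain r R where r: "r \<in> W" "M = add_mset r R" "count M' r < count M r" "add_mset v R \<in> edge_prods H s"
      using trade_within_W[OF M low parts 2 v] .
    then show ?thesis using lex[OF r(2,3)] 2 by (intro exchangeableI[OF r(2) _ v]) auto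
  qed
qed

subsection \<open>The order of the generators\<close>

text \<open>Generators of \<open>N\<close>-degree at least \<open>s\<close> come first, in the order \<open>f\<close>.  The others are sorted by
  decreasing \<open>N\<close>-degree and then, all generators having degree \<open>2 * s\<close>, by decreasing \<open>{x, y}\<close>-degree.\<close>

definition twin_key :: "nat \<Rightarrow> ('b monomial \<Rightarrow> int) \<Rightarrow> 'b list \<Rightarrow> 'b monomial \<Rightarrow> int list" where
  "twin_key s f vs M =
     (if deg_in N M < s then [- int (deg_in N M), int (deg_in W M)] else [- int s, f M]) @ lex_key vs M"

lemma inj_on_twin_key:
  assumes "\<Union>H \<subseteq> set vs"
  shows "inj_on (twin_key s f vs) (edge_prods H s)"
proof -
  have "edge_prods H s \<subseteq> {M. set_mset M \<subseteq> set vs}" using set_mset_edge_prods assms by blast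
  then have "inj_on (lex_key vs) (edge_prods H s)" by (rule inj_on_subset[OF inj_on_lex_key])
  moreover have "lex_key vs M = lex_key vs M'" if "twin_key s f vs M = twin_key s f vs M'" for M M'
    using that by (simp add: twin_key_def split: if_splits)
  ultimately show ?thesis by (meson inj_onD inj_onI)
qed

lemma exchangeable_equal_N_part:
  assumes M: "M \<in> edge_prods H s" "deg_in N M < s" and M': "M' \<in> edge_prods H s"
    and N_part: "restrict_mset N M' = restrict_mset N M"
    and less: "twin_key s f vs M' < twin_key s f vs M"
  shows "exchangeable {L \<in> edge_prods H s. twin_key s f vs L < twin_key s f vs M} M M'"
proof -
  have degN: "deg_in N M' = deg_in N M" using N_part by (simp add: deg_in_def)
  then consider "deg_in W M' < deg_in W M" | "deg_in W M' = deg_in W M" "lex_key vs M' < lex_key vs M"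
    using less M(2) by (auto simp: twin_key_def)
  then show ?thesis
  proof cases
    case 1
    then have "count M x + count M y < count M' x + count M' y"
      using size_eq_degrees[of M] size_eq_degrees[of M'] size_edge_prods[OF M(1)] size_edge_prods[OF M'] degN
      by linarith
    then have "count M x < count M' x \<or> count M y < count M' y" by linarith
    then obtain z where z: "z \<in> {x, y}" "count M z < count M' z" by blast
    have "0 < deg_in W M" using 1 by linarith
    then obtain q where q: "q \<in> W" "q \<in># M" by (rule deg_in_posE)
    obtain R where R: "M = add_mset q R" using q(2) by (metis mset_add)
    have "add_mset q R \<in> edge_prods H s" "deg_in N R \<le> s" using M q(1) R by auto
    then have "add_mset z R \<in> edge_prods H s" using q(1) z(1) by (rule trade_W_for_twin)
    then show ?thesis
      using M(2) q(1) z by (intro exchangeableI[OF R _ z(2)]) (auto simp: R twin_key_def)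
  next
    case 2
    show ?thesis
      by (rule exchangeable_mono[OF exchangeable_equal_degrees[OF M(1) M' less_imp_le[OF M(2)] N_part 2]])
        (use M(2) in \<open>auto simp: twin_key_def\<close>)
  qed
qed

lemma exchangeable_low:
  assumes M: "M \<in> edge_prods H s" "deg_in N M < s" and M': "M' \<in> edge_prods H s"
    and less: "twin_key s f vs M' < twin_key s f vs M"
  shows "exchangeable {L \<in> edge_prods H s. twin_key s f vs L < twin_key s f vs M} M M'"
proof (cases "\<exists>p\<in>N. count M p < count M' p")
  case True
  then obtain p where p: "p \<in> N" "count M p < count M' p" by blast
  obtain R where R: "M = add_mset x R" "add_mset p R \<in> edge_prods H s" using trade_twin_for_N[OF M p(1)] .
  then show ?thesis
    using M(2) p by (intro exchangeableI[OF R(1) _ p(2)]) (auto simp: twin_key_def)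
next
  case False
  have "deg_in N M \<le> deg_in N M'" using less M(2) by (auto simp: twin_key_def split: if_splits)
  then have "restrict_mset N M' = restrict_mset N M"
    using False ex_count_less_filter[of "\<lambda>v. v \<in> N" M M'] unfolding deg_in_def by metis
  then show ?thesis using M M' less by (intro exchangeable_equal_N_part)
qed

lemma exchangeable_high:
  fixes f :: "'b \<Rightarrow> 'c" and idx :: "'c monomial \<Rightarrow> nat" and s :: nat and vs :: "'b list"
  defines "key \<equiv> twin_key s (\<lambda>M. int (idx (image_mset f M))) vs"
  assumes Q: "\<And>M. image_mset f M \<in> Q \<longleftrightarrow> M \<in> edge_prods H s \<and> s \<le> deg_in N M"
    and idx: "linear_quotient_key Q idx"
    and M: "M \<in> edge_prods H s" "s \<le> deg_in N M" and M': "M' \<in> edge_prods H s"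
    and less: "key M' < key M"
  shows "exchangeable {L \<in> edge_prods H s. key L < key M} M M'"
proof -
  have "s \<le> deg_in N M'" using less M(2) by (auto simp: key_def twin_key_def split: if_splits)
  then have images: "image_mset f M \<in> Q" "image_mset f M' \<in> Q" using Q M M' by auto
  consider "idx (image_mset f M') < idx (image_mset f M)"
    | "idx (image_mset f M') = idx (image_mset f M)" "lex_key vs M' < lex_key vs M"
    using less M(2) \<open>s \<le> deg_in N M'\<close> by (auto simp: key_def twin_key_def)
  then show ?thesis
  proof cases
    case 1
    then have "exchangeable {m \<in> Q. idx m < idx (image_mset f M)} (image_mset f M) (image_mset f M')"
      using idx images unfolding linear_quotient_key_def by blast
    from exchangeable_vimage[OF this] show ?thesis
      by (rule exchangeable_mono) (use Q M(2) in \<open>auto simp: key_def twin_key_def\<close>)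
  next
    case 2
    then have "image_mset f M' = image_mset f M"
      using idx images unfolding linear_quotient_key_def by (metis inj_onD)
    from exchangeable_fiber[OF this 2(2)] show ?thesis
    proof (rule exchangeable_mono, safe)
      fix L assume L: "image_mset f L = image_mset f M" "lex_key vs L < lex_key vs M"
      then have "L \<in> edge_prods H s \<and> s \<le> deg_in N L" using Q images(1) by metis
      then show "L \<in> edge_prods H s" "key L < key M" using L M(2) by (simp_all add: key_def twin_key_def)
    qed
  qed
qed

lemma linear_quotient_key_twin_key:
  fixes idx :: "'c monomial \<Rightarrow> nat"
  assumes Q: "\<And>M. image_mset f M \<in> Q \<longleftrightarrow> M \<in> edge_prods H s \<and> s \<le> deg_in N M"
    and idx: "linear_quotient_key Q idx" and vs: "\<Union>H \<subseteq> set vs"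
  shows "linear_quotient_key (edge_prods H s) (twin_key s (\<lambda>M. int (idx (image_mset f M))) vs)"
  unfolding linear_quotient_key_def
proof (intro conjI ballI impI)
  let ?key = "twin_key s (\<lambda>M. int (idx (image_mset f M))) vs"
  show "inj_on ?key (edge_prods H s)" using vs by (rule inj_on_twin_key)
  fix M M' assume M: "M \<in> edge_prods H s" "M' \<in> edge_prods H s" "?key M' < ?key M"
  show "exchangeable {L \<in> edge_prods H s. ?key L < ?key M} M M'"
  proof (cases "deg_in N M < s")
    case True
    then show ?thesis using M by (intro exchangeable_low)
  next
    case False
    then show ?thesis using M by (intro exchangeable_high[OF Q idx]) auto
  qed
qed

subsection \<open>Products without the twin edge\<close>

abbreviation untwinned_edges :: "'b set set" where "untwinned_edges \<equiv> H - {{x, y}}"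

abbreviation twin_power :: "nat \<Rightarrow> 'b monomial" where
  "twin_power k \<equiv> replicate_mset k x + replicate_mset k y"

sublocale untwinned: simple_edges untwinned_edges
  by standard (simp add: card_edge)

text \<open>An edge \<open>ab\<close> inside \<open>N\<close> absorbs the edge \<open>xy\<close> by \<open>(xy)(ab) = (xa)(yb)\<close>.\<close>

lemma absorb_twin_edge:
  assumes "M \<in> edge_prods untwinned_edges s" "s < deg_in N M"
  shows "add_mset x (add_mset y M) \<in> edge_prods untwinned_edges (Suc s)"
  using assms
proof (induction s arbitrary: M)
  case (Suc s)
  from Suc.prems(1) obtain a b L where ab: "{a, b} \<in> untwinned_edges" and M: "M = add_mset a (add_mset b L)"
    and L: "L \<in> edge_prods untwinned_edges s" by (rule untwinned.edge_prods_SucE)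
  show ?case
  proof (cases "a \<in> N \<and> b \<in> N")
    case True
    then have "{x, a} \<in> untwinned_edges" "{y, b} \<in> untwinned_edges"
      using xN yN by (auto simp: doubleton_eq_iff)
    then have "add_mset x (add_mset a (add_mset y (add_mset b L))) \<in> edge_prods untwinned_edges (Suc (Suc s))"
      using L by (intro untwinned.edge_prods_SucI)
    then show ?thesis by (simp add: M add_mset_commute)
  next
    case False
    then have "s < deg_in N L" using Suc.prems(2) M by (auto split: if_splits)
    then have "add_mset a (add_mset b (add_mset x (add_mset y L))) \<in> edge_prods untwinned_edges (Suc (Suc s))"
      using untwinned.edge_prods_SucI[OF ab] Suc.IH[OF L] by blast
    then show ?thesis by (simp add: M add_mset_commute)
  qed
qed (simp add: edge_prods_0)

lemma absorb_twin_edges: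
  assumes "M \<in> edge_prods untwinned_edges s" "s + k \<le> deg_in N M"
  shows "twin_power k + M \<in> edge_prods untwinned_edges (s + k)"
  using assms(2)
proof (induction k)
  case (Suc k)
  then have "s + k < deg_in N (twin_power k + M)" by simp
  then show ?case
    using Suc absorb_twin_edge[of "twin_power k + M"]
    by (simp add: add_mset_commute)
qed (simp add: assms(1))

lemma split_off_twin_edges:
  assumes "M \<in> edge_prods H s"
  obtains k t L where "s = t + k" "M = twin_power k + L" "L \<in> edge_prods untwinned_edges t"
proof -
  have "\<exists>k t L. s = t + k \<and> M = twin_power k + L \<and> L \<in> edge_prods untwinned_edges t"
    using assms
  proof (induction s arbitrary: M)
    case (Suc s)
    from Suc.prems obtain a b M' where ab: "{a, b} \<in> H" and M: "M = add_mset a (add_mset b M')"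
      and M': "M' \<in> edge_prods H s" by (rule edge_prods_SucE)
    obtain k t L where L: "s = t + k" "M' = twin_power k + L" "L \<in> edge_prods untwinned_edges t"
      using Suc.IH[OF M'] by blast
    show ?case
    proof (cases "{a, b} = {x, y}")
      case True
      then have "M = twin_power (Suc k) + L"
        using L(2) M by (auto simp: doubleton_eq_iff add_mset_commute)
      then show ?thesis using L(1,3) by (intro exI[of _ "Suc k"] exI[of _ t] exI[of _ L]) auto
    next
      case False
      then have "add_mset a (add_mset b L) \<in> edge_prods untwinned_edges (Suc t)"
        using ab L(3) by (intro untwinned.edge_prods_SucI) auto
      then show ?thesis using L(1,2) M
        by (intro exI[of _ k] exI[of _ "Suc t"] exI[of _ "add_mset a (add_mset b L)"]) auto
    qed
  qed (auto simp: edge_prods_0)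
  then show ?thesis using that by blast
qed

lemma untwinned_imp_deg_in_N_ge: "M \<in> edge_prods untwinned_edges s \<Longrightarrow> s \<le> deg_in N M"
proof (induction s arbitrary: M)
  case (Suc s)
  from Suc.prems obtain a b L where ab: "{a, b} \<in> untwinned_edges" and M: "M = add_mset a (add_mset b L)"
    and L: "L \<in> edge_prods untwinned_edges s" by (rule untwinned.edge_prods_SucE)
  have "a \<in> N \<or> b \<in> N" using ab ends_cover by blast
  then show ?case using Suc.IH[OF L] M by auto
qed simp

lemma edge_prods_untwinned_iff:
  "M \<in> edge_prods untwinned_edges s \<longleftrightarrow> M \<in> edge_prods H s \<and> s \<le> deg_in N M"
proof
  assume "M \<in> edge_prods untwinned_edges s"
  then show "M \<in> edge_prods H s \<and> s \<le> deg_in N M"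
    using untwinned_imp_deg_in_N_ge edge_prods_mono[of untwinned_edges H] by blast
next
  assume M: "M \<in> edge_prods H s \<and> s \<le> deg_in N M"
  then obtain k t L where L: "s = t + k" "M = twin_power k + L" "L \<in> edge_prods untwinned_edges t"
    using split_off_twin_edges by blast
  then have "t + k \<le> deg_in N L" using M by simp
  then show "M \<in> edge_prods untwinned_edges s" using absorb_twin_edges[OF L(3)] L(1,2) by simp
qed

end

section \<open>Expansions\<close>

lemma image_mset_edge_prods_iff:
  assumes "simple_edges E" "simple_edges E'" and edge_iff: "\<And>u v. {u, v} \<in> E' \<longleftrightarrow> {f u, f v} \<in> E"
  shows "image_mset f M \<in> edge_prods E s \<longleftrightarrow> M \<in> edge_prods E' s"
proof (induction s arbitrary: M)
  case (Suc s)
  interpret E: simple_edges E by fact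
  interpret E': simple_edges E' by fact
  show ?case
  proof
    assume "image_mset f M \<in> edge_prods E (Suc s)"
    then obtain a b L where ab: "{a, b} \<in> E" "image_mset f M = add_mset a (add_mset b L)"
      and L: "L \<in> edge_prods E s" by (rule E.edge_prods_SucE)
    then obtain u v K where "M = add_mset u (add_mset v K)" "f u = a" "f v = b" "image_mset f K = L"
      by (blast dest: msed_map_invR)
    then show "M \<in> edge_prods E' (Suc s)"
      using ab(1) L edge_iff Suc.IH by (auto intro: E'.edge_prods_SucI)
  next
    assume "M \<in> edge_prods E' (Suc s)"
    then obtain u v K where "{u, v} \<in> E'" "M = add_mset u (add_mset v K)" "K \<in> edge_prods E' s"
      by (rule E'.edge_prods_SucE)
    then show "image_mset f M \<in> edge_prods E (Suc s)"
      using edge_iff Suc.IH by (auto intro: E.edge_prods_SucI)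
  qed
qed (simp add: edge_prods_0)

primrec collapse :: "'a \<Rightarrow> 'a option \<Rightarrow> 'a" where
  "collapse x None = x"
| "collapse x (Some v) = v"

definition neighbours :: "'a set set \<Rightarrow> 'a \<Rightarrow> 'a set" where
  "neighbours E x = {b. {x, b} \<in> E}"

lemma twin_edge_expansion: "{Some x, None} \<in> expansion_edges E x"
  by (simp add: expansion_edges_def)

lemma finite_expansion_edges:
  assumes "finite E" "\<And>e. e \<in> E \<Longrightarrow> finite e"
  shows "finite (expansion_edges E x)"
proof -
  have "finite (\<Union>E)" using assms by blast
  then have "finite {b. {x, b} \<in> E}" by (rule rev_finite_subset) auto
  then show ?thesis using assms(1) by (simp add: expansion_edges_def)
qed

context simple_edges
begin

lemma simple_edges_expansion: "simple_edges (expansion_edges E x)"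
  by standard (auto simp: expansion_edges_def card_image card_edge)

lemma expansion_edge_iff:
  "{u, v} \<in> expansion_edges E x - {{Some x, None}} \<longleftrightarrow> {collapse x u, collapse x v} \<in> E"
proof -
  have no_loop: "{a} \<notin> E" for a using card_edge[of "{a}"] by auto
  have old: "{Some a, Some b} \<in> (\<lambda>e. Some ` e) ` E \<longleftrightarrow> {a, b} \<in> E" for a b
  proof -
    have "{Some a, Some b} = Some ` {a, b}" by simp
    then show ?thesis by (metis (mono_tags, lifting) image_iff inj_Some inj_image_eq_iff)
  qed
  have new: "{None, z} \<notin> (\<lambda>e. Some ` e) ` E" "{z, None} \<notin> (\<lambda>e. Some ` e) ` E" for z by auto
  show ?thesis
    by (cases u; cases v)
      (auto simp: expansion_edges_def old new no_loop doubleton_eq_iff insert_commute)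
qed

lemma gapfree_expansion_cover:
  assumes gap: "gapfree (expansion_edges E x)" and e: "e \<in> E"
  shows "e \<inter> neighbours E x \<noteq> {}"
proof (cases "x \<in> e")
  case True
  obtain b where "e = {x, b}" using edge_at_vertexE[OF e True] .
  then show ?thesis using e by (auto simp: neighbours_def)
next
  case False
  have "Some ` e \<in> expansion_edges E x" using e by (simp add: expansion_edges_def)
  moreover have "Some ` e \<inter> {Some x, None} = {}" using False by auto
  ultimately obtain f where f: "f \<in> expansion_edges E x" "Some ` e \<inter> f \<noteq> {}" "{Some x, None} \<inter> f \<noteq> {}"
    using gap twin_edge_expansion unfolding gapfree_def by meson
  then obtain b where b: "b \<in> e" "Some b \<in> f" by blast
  obtain z where z: "z \<in> {Some x, None}" "z \<in> f" using f(3) by blast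
  have "z \<noteq> Some b" using b(1) z(1) False by auto
  obtain c where c: "f = {z, c}" using simple_edges.edge_at_vertexE[OF simple_edges_expansion f(1) z(2)] .
  then have fz: "f = {z, Some b}" using b(2) \<open>z \<noteq> Some b\<close> by auto
  have "f \<noteq> {Some x, None}" using b False by (auto simp: doubleton_eq_iff)
  then have "{collapse x z, b} \<in> E" using f(1) expansion_edge_iff[of z "Some b" x] fz by simp
  then show ?thesis using b(1) z(1) by (auto simp: neighbours_def)
qed

lemma dominating_twins_expansion:
  assumes gap: "gapfree (expansion_edges E x)"
  shows "dominating_twins (expansion_edges E x) (Some x) None (Some ` neighbours E x)"
proof -
  let ?H = "expansion_edges E x"
  interpret H: simple_edges ?H by (rule simple_edges_expansion)
  show ?thesis
  proof
    show "{Some x, None} \<in> ?H" by (rule twin_edge_expansion)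
    show "{Some x, p} \<in> ?H" "{None, p} \<in> ?H" if "p \<in> Some ` neighbours E x" for p
      using that expansion_edge_iff[of "Some x" p x] expansion_edge_iff[of None p x] by (auto simp: neighbours_def)
    show "e \<inter> Some ` neighbours E x \<noteq> {}" if e: "e \<in> ?H" "e \<noteq> {Some x, None}" for e
    proof -
      from e consider g where "g \<in> E" "e = Some ` g" | b where "{x, b} \<in> E" "e = {None, Some b}"
        by (auto simp: expansion_edges_def)
      then show ?thesis
        using gapfree_expansion_cover[OF gap] by cases (auto simp: neighbours_def)
    qed
  qed
qed

lemma linear_quotients_expansion:
  assumes fin: "finite E" and lq: "linear_quotients (edge_ideal_pow E s)"
    and gap: "gapfree (expansion_edges E x)"
  shows "linear_quotients (edge_ideal_pow (expansion_edges E x) s)"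
proof -
  let ?H = "expansion_edges E x"
  interpret H: dominating_twins ?H "Some x" None "Some ` neighbours E x"
    using gap by (rule dominating_twins_expansion)
  obtain idx :: "'a monomial \<Rightarrow> nat" where idx: "linear_quotient_key (edge_prods E s) idx"
    using lq size_edge_prods unfolding edge_ideal_pow_eq by (metis linear_quotientsE)
  have "image_mset (collapse x) M \<in> edge_prods E s \<longleftrightarrow> M \<in> edge_prods (?H - {{Some x, None}}) s" for M
    using simple_edges_axioms H.untwinned.simple_edges_axioms expansion_edge_iff
    by (rule image_mset_edge_prods_iff)
  then have high: "image_mset (collapse x) M \<in> edge_prods E s \<longleftrightarrow>
      M \<in> edge_prods ?H s \<and> s \<le> deg_in (Some ` neighbours E x) M" for M
    by (simp add: H.edge_prods_untwinned_iff)
  have finH: "finite ?H" using fin finite_edge by (rule finite_expansion_edges)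
  then have "finite (\<Union>?H)" using H.finite_edge by blast
  then obtain vs where "\<Union>?H \<subseteq> set vs" by (metis finite_list order_refl)
  from H.linear_quotient_key_twin_key[OF high idx this] show ?thesis
    unfolding edge_ideal_pow_eq using finite_edge_prods[OF finH] H.size_edge_prods by (blast intro: linear_quotientsI)
qed

end

theorem theorem3p4:
  fixes V :: "'a set" and E :: "'a set set" and x :: 'a and s :: nat
  assumes "simple_graph V E"
    and "s \<ge> 1"
    and "linear_quotients (edge_ideal_pow E s)"
    and "x \<in> V"
  shows "linear_quotients (edge_ideal_pow (expansion_edges E x) s)
           \<longleftrightarrow> gapfree (expansion_edges E x)"
proof
  interpret simple_edges E
    using assms(1) by unfold_locales (simp add: simple_graph_def)
  have "E \<subseteq> Pow V" "finite V" using assms(1) by (auto simp: simple_graph_def)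
  then have "finite E" by (meson finite_Pow_iff finite_subset)
  then show "linear_quotients (edge_ideal_pow (expansion_edges E x) s)" if "gapfree (expansion_edges E x)"
    using assms(3) that by (rule linear_quotients_expansion)
  show "gapfree (expansion_edges E x)" if "linear_quotients (edge_ideal_pow (expansion_edges E x) s)"
    using simple_edges_expansion assms(2) that by (rule simple_edges.linear_quotients_imp_gapfree)
qed

end
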